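(* Let $\Lambda$ and $K^\Lambda$ be the wave cone and the $\Lambda$-convex hull of 3D ideal MHD in the variables $(u,b,S,a)\in\mathbb{R}^3\times\mathbb{R}^3\times\mathcal{S}^{3\times3}\times\mathbb{R}^3$. If $(u,b,S,a)\in\Lambda$ or $(u,b,S,a)\in K^\Lambda$, then $a\cdot b=0$.
   Context: $\mathcal{S}^{3\times3}$ is the space of symmetric real $3\times3$ matrices; $(v\otimes w)_{ij}=v_iw_j$. Constraint set: $K=\{(u,b,S,a)\in\mathbb{R}^3\times\mathbb{R}^3\times\mathcal{S}^{3\times3}\times\mathbb{R}^3: S=u\otimes u-b\otimes b+\Pi I\text{ for some }\Pi\in\mathbb{R},\ a=b\times u\}$. Wave cone: $\Lambda$ is the set of $(u,b,S,a)\in\mathbb{R}^3\times\mathbb{R}^3\times\mathcal{S}^{3\times3}\times\mathbb{R}^3$ for which there is $(\xi,c)\in(\mathbb{R}^3\setminus\{0\})\times\mathbb{R}$ with $S\xi+cu=0$, $\xi\times a+cb=0$, $u\cdot\xi=b\cdot\xi=0$. A function $f:\mathbb{R}^3\times\mathbb{R}^3\times\mathcal{S}^{3\times3}\times\mathbb{R}^3\to\mathbb{R}$ is $\Lambda$-convex if $t\mapsto f(V+tW)$ is convex on $\mathbb{R}$ for every $V$ and every $W\in\Lambda$. The $\Lambda$-convex hull $K^\Lambda$ is the set of points $W$ such that $f(W)\le0$ for every $\Lambda$-convex $f$ with $f|_K\le0$. *)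

theory Defs
  imports "HOL-Analysis.Analysis"
begin

text \<open>
  States \<open>(u, b, S, a)\<close>. The type allows an arbitrary matrix \<open>S\<close>; the actual state space, with
  symmetric \<open>S\<close>, is the linear subspace \<open>mhd_space\<close>.
\<close>

type_synonym mhd_state = "(real^3) \<times> (real^3) \<times> (real^3^3) \<times> (real^3)"

definition mhd_space :: "mhd_state set" where
  "mhd_space = {(u, b, S, a). transpose S = S}"

definition outer :: "real^'n \<Rightarrow> real^'m \<Rightarrow> real^'m^'n" where
  "outer v w = (\<chi> i j. v $ i * w $ j)"

definition mhd_constraint :: "mhd_state set" where
  "mhd_constraint = {(u, b, S, a) \<in> mhd_space.
     (\<exists>q::real. S = outer u u - outer b b + q *\<^sub>R mat 1) \<and> a = cross3 b u}"

definition mhd_wave_cone :: "mhd_state set" where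
  "mhd_wave_cone = {(u, b, S, a) \<in> mhd_space.
     \<exists>(\<xi>::real^3) (c::real). \<xi> \<noteq> 0 \<and>
       S *v \<xi> + c *\<^sub>R u = 0 \<and> cross3 \<xi> a + c *\<^sub>R b = 0 \<and> u \<bullet> \<xi> = 0 \<and> b \<bullet> \<xi> = 0}"

text \<open>
  In the next two definitions \<open>X\<close> is the ambient linear space and \<open>\<Lambda> \<subseteq> X\<close> a cone. A function on
  \<open>X\<close> is represented by a total function on the type whose values outside \<open>X\<close> are irrelevant:
  for \<open>V \<in> X\<close> and \<open>W \<in> \<Lambda>\<close> the line \<open>V + t W\<close> stays in \<open>X\<close>.
\<close>

definition cone_convex_on :: "'a::real_vector set \<Rightarrow> 'a set \<Rightarrow> ('a \<Rightarrow> real) \<Rightarrow> bool" where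
  "cone_convex_on X \<Lambda> f \<longleftrightarrow>
     (\<forall>V\<in>X. \<forall>W\<in>\<Lambda>. convex_on UNIV (\<lambda>t::real. f (V + t *\<^sub>R W)))"

definition cone_convex_hull :: "'a::real_vector set \<Rightarrow> 'a set \<Rightarrow> 'a set \<Rightarrow> 'a set" where
  "cone_convex_hull X \<Lambda> K =
     {W \<in> X. \<forall>f. cone_convex_on X \<Lambda> f \<and> (\<forall>V\<in>K. f V \<le> 0) \<longrightarrow> f W \<le> 0}"

end

theory Submission
  imports Defs
begin

text \<open>
  The quadratic form \<open>a \<bullet> b\<close> vanishes on the wave cone, so it is affine along
  every direction of the cone. It also vanishes on the constraint set, where \<open>a = b \<times> u\<close>, and
  testing the hull with both signs of this form shows that it vanishes there too.
\<close>

lemma mhd_wave_cone_inner_eq_0: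
  assumes "(u, b, S, a) \<in> mhd_wave_cone"
  shows "a \<bullet> b = 0"
proof -
  obtain \<xi> c where "\<xi> \<noteq> 0" and eq: "cross3 \<xi> a + c *\<^sub>R b = 0" and "b \<bullet> \<xi> = 0"
    using assms by (auto simp: mhd_wave_cone_def)
  \<comment> \<open>Crossing with \<open>b\<close> removes the unknown \<open>c\<close>, since
    \<open>b\<close> is parallel to itself. The triple product expands to \<open>(a \<bullet> b)
    *\<^sub>R \<xi> - (b \<bullet> \<xi>) *\<^sub>R a\<close>, whose second term drops out by
    orthogonality.\<close>
  have "(a \<bullet> b) *\<^sub>R \<xi> = cross3 b (cross3 \<xi> a + c *\<^sub>R b)"
    using \<open>b \<bullet> \<xi> = 0\<close> by (simp add: cross_add_right cross_mult_right Lagrange inner_commute)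
  also have "\<dots> = 0"
    by (simp add: eq)
  finally show ?thesis
    using \<open>\<xi> \<noteq> 0\<close> by simp
qed

lemma mhd_constraint_inner_eq_0:
  assumes "(u, b, S, a) \<in> mhd_constraint"
  shows "a \<bullet> b = 0"
  using assms by (auto simp: mhd_constraint_def dot_cross_self)

text \<open>The hull gives only upper bounds, so the factor \<open>r\<close> of arbitrary sign is
  kept to obtain both inequalities from one family of test functions.\<close>

lemma cone_convex_on_scaled_inner:
  "cone_convex_on X mhd_wave_cone (\<lambda>(u, b, S, a). r * (a \<bullet> b))"
  unfolding cone_convex_on_def
proof (intro ballI)
  fix V W :: mhd_state
  assume "W \<in> mhd_wave_cone"
  obtain u b S a where V: "V = (u, b, S, a)" by (cases V)
  obtain u' b' S' a' where W: "W = (u', b', S', a')" by (cases W)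
  have "a' \<bullet> b' = 0"
    using \<open>W \<in> mhd_wave_cone\<close> unfolding W by (rule mhd_wave_cone_inner_eq_0)
  \<comment> \<open>The coefficient of \<open>t^2\<close> is \<open>r * (a' \<bullet> b')\<close>,
    which is zero, so only an affine function of \<open>t\<close> remains.\<close>
  then have eq: "(\<lambda>t. case V + t *\<^sub>R W of (u, b, S, a) \<Rightarrow> r * (a \<bullet> b)) =
      (\<lambda>t. r * (a \<bullet> b) + t * (r * (a \<bullet> b' + a' \<bullet> b)))"
    by (simp add: V W inner_add_left inner_add_right algebra_simps)
  show "convex_on UNIV (\<lambda>t. case V + t *\<^sub>R W of (u, b, S, a) \<Rightarrow> r * (a \<bullet> b))"
    unfolding eq by (rule convex_onI) (simp_all add: algebra_simps)
qed

theorem theorem5p1: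
  fixes u b a :: "real^3" and S :: "real^3^3"
  assumes "(u, b, S, a) \<in> mhd_wave_cone \<or>
           (u, b, S, a) \<in> cone_convex_hull mhd_space mhd_wave_cone mhd_constraint"
  shows "a \<bullet> b = 0"
  using assms
proof
  assume "(u, b, S, a) \<in> mhd_wave_cone"
  then show ?thesis by (rule mhd_wave_cone_inner_eq_0)
next
  assume hull: "(u, b, S, a) \<in> cone_convex_hull mhd_space mhd_wave_cone mhd_constraint"
  have le: "r * (a \<bullet> b) \<le> 0" for r
  proof -
    let ?f = "\<lambda>(u, b, S, a). r * (a \<bullet> b)"
    have "\<forall>V\<in>mhd_constraint. ?f V \<le> 0"
      by (auto dest: mhd_constraint_inner_eq_0)
    with hull have "?f (u, b, S, a) \<le> 0"
      using cone_convex_on_scaled_inner[of mhd_space r]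
      unfolding cone_convex_hull_def by blast
    then show ?thesis by simp
  qed
  show ?thesis
    using le[of 1] le[of "-1"] by simp
qed

end
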